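(* Let $k\ge1$ be an integer. For every real $c<k+1$, no randomized online algorithm for the $k$-Canadian Traveller Problem with predictions is $c$-competitive against an oblivious adversary, even when restricted to instances whose prediction error is at most $2$ and whose graph is path-disjoint; that is, for every randomized algorithm there is such an instance with $\mathbb{E}[ALG]>c\cdot OPT$.
   Context: $k$-Canadian Traveller Problem ($k$-CTP) with predictions: an instance consists of a connected undirected graph $G=(V,E)$, a source $s$, a destination $t$, a nonnegative cost function $c:E\to\mathbb{R}^+$, an unknown set $B\subseteq E$ of blocked edges with $|B|\le k$ such that $G-B$ contains an $s$-$t$ path, and a predicted set $B_p\subseteq E$ of blocked edges with $|B_p|\le k$. The traveller knows $G,c,s,t,k,B_p$ in advance, starts at $s$, and learns whether an edge is blocked only upon reaching one of its endpoints; blocked edges cannot be traversed. $ALG$ is the (random) total cost travelled, $OPT$ the cost of a shortest $s$-$t$ path in $G-B$. A randomized algorithm is $c$-competitive against an oblivious adversary if $\mathbb{E}[ALG]\le c\cdot OPT$ on every instance (instances fixed independently of the algorithm's random choices). The prediction error is $|B\triangle B_p|$. A graph is path-disjoint if all its $s$-$t$ paths are pairwise node-disjoint apart from $s$ and $t$. *)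

theory Defs
  imports "HOL-Probability.Probability"
begin

text \<open>Finite simple undirected graphs; an edge is a two-element set of vertices.\<close>

definition simple_graph :: "nat set \<Rightarrow> nat set set \<Rightarrow> bool" where
  "simple_graph V E \<longleftrightarrow>
     finite V \<and> (\<forall>e\<in>E. \<exists>u\<in>V. \<exists>v\<in>V. u \<noteq> v \<and> e = {u, v})"

definition walk_edges :: "nat list \<Rightarrow> nat set list" where
  "walk_edges p = map (\<lambda>(u, v). {u, v}) (zip p (tl p))"

definition walk_cost :: "(nat set \<Rightarrow> real) \<Rightarrow> nat list \<Rightarrow> real" where
  "walk_cost w p = sum_list (map w (walk_edges p))"

definition is_path :: "nat set set \<Rightarrow> nat \<Rightarrow> nat \<Rightarrow> nat list \<Rightarrow> bool" where
  "is_path E u v p \<longleftrightarrow>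
     p \<noteq> [] \<and> hd p = u \<and> last p = v \<and> distinct p \<and> set (walk_edges p) \<subseteq> E"

definition connected_graph :: "nat set \<Rightarrow> nat set set \<Rightarrow> bool" where
  "connected_graph V E \<longleftrightarrow>
     simple_graph V E \<and> V \<noteq> {} \<and> (\<forall>u\<in>V. \<forall>v\<in>V. \<exists>p. is_path E u v p)"

text \<open>The part of an instance that the traveller knows in advance. The parameter \<open>k\<close> is not a
  field, since it is fixed for the whole problem. Only the costs of members of \<open>edges\<close> matter.\<close>

record ctp_input =
  verts :: "nat set"
  edges :: "nat set set"
  source :: nat
  dest :: nat
  cost :: "nat set \<Rightarrow> real"
  predicted :: "nat set set"

text \<open>An instance is an input \<open>I\<close> together with the hidden set \<open>B\<close> of blocked edges.\<close>

definition ctp_instance :: "nat \<Rightarrow> ctp_input \<Rightarrow> nat set set \<Rightarrow> bool" where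
  "ctp_instance k I B \<longleftrightarrow>
     connected_graph (verts I) (edges I) \<and>
     source I \<in> verts I \<and> dest I \<in> verts I \<and>
     (\<forall>e\<in>edges I. 0 \<le> cost I e) \<and>
     predicted I \<subseteq> edges I \<and> card (predicted I) \<le> k \<and>
     B \<subseteq> edges I \<and> card B \<le> k \<and>
     (\<exists>p. is_path (edges I - B) (source I) (dest I) p)"

definition prediction_error :: "ctp_input \<Rightarrow> nat set set \<Rightarrow> nat" where
  "prediction_error I B = card ((B - predicted I) \<union> (predicted I - B))"

definition path_disjoint :: "ctp_input \<Rightarrow> bool" where
  "path_disjoint I \<longleftrightarrow>
     (\<forall>p q. is_path (edges I) (source I) (dest I) p \<longrightarrow>
            is_path (edges I) (source I) (dest I) q \<longrightarrow> p \<noteq> q \<longrightarrow>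
            set p \<inter> set q \<subseteq> {source I, dest I})"

definition opt_cost :: "ctp_input \<Rightarrow> nat set set \<Rightarrow> real" where
  "opt_cost I B =
     Min {walk_cost (cost I) p | p. is_path (edges I - B) (source I) (dest I) p}"

text \<open>A history lists, most recent first, the vertices visited so far, each with the set of
  incident blocked edges revealed there. A deterministic online algorithm maps the input and
  the history to the vertex to move to next.\<close>

type_synonym history = "(nat \<times> nat set set) list"
type_synonym strategy = "ctp_input \<Rightarrow> history \<Rightarrow> nat"

definition observe :: "nat set set \<Rightarrow> nat \<Rightarrow> nat \<times> nat set set" where
  "observe B v = (v, {e\<in>B. v \<in> e})"

text \<open>The trip ends at the destination. If the proposed move does not follow an unblocked edge,
  the history is unchanged, so the traveller stays where it is forever.\<close>

primrec run :: "strategy \<Rightarrow> ctp_input \<Rightarrow> nat set set \<Rightarrow> nat \<Rightarrow> history" where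
  "run S I B 0 = [observe B (source I)]"
| "run S I B (Suc n) =
     (let h = run S I B n; u = fst (hd h); v = S I h
      in if u \<noteq> dest I \<and> {u, v} \<in> edges I - B then observe B v # h else h)"

definition at_dest :: "strategy \<Rightarrow> ctp_input \<Rightarrow> nat set set \<Rightarrow> nat \<Rightarrow> bool" where
  "at_dest S I B n \<longleftrightarrow> fst (hd (run S I B n)) = dest I"

text \<open>A traveller that never arrives, even one whose travelled cost stays bounded, has failed
  and is charged \<open>\<infinity>\<close>. The reversed order of the history is immaterial to the cost.\<close>

definition alg_cost :: "strategy \<Rightarrow> ctp_input \<Rightarrow> nat set set \<Rightarrow> ennreal" where
  "alg_cost S I B =
     (if \<exists>n. at_dest S I B n
      then ennreal (walk_cost (cost I) (map fst (run S I B (LEAST n. at_dest S I B n))))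
      else \<infinity>)"

text \<open>A randomized online algorithm is a random deterministic one: \<open>A r\<close> is the strategy followed
  when the random choices are \<open>r\<close>, and each single decision is a random variable.\<close>

definition randomized_algorithm :: "'r measure \<Rightarrow> ('r \<Rightarrow> strategy) \<Rightarrow> bool" where
  "randomized_algorithm M A \<longleftrightarrow>
     prob_space M \<and> (\<forall>I h. (\<lambda>r. A r I h) \<in> measurable M (count_space UNIV))"

definition expected_cost ::
    "'r measure \<Rightarrow> ('r \<Rightarrow> strategy) \<Rightarrow> ctp_input \<Rightarrow> nat set set \<Rightarrow> ennreal" where
  "expected_cost M A I B = (\<integral>\<^sup>+ r. alg_cost (A r) I B \<partial>M)"

end

theory Submission
  imports Defs
begin

text \<open>Take \<open>k + 1\<close> internally disjoint paths \<open>s - j - t\<close> with costs 1 and 0, and block the last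
  edge of all of them but one. Any two such sets of blocked edges differ in at most two edges, so one
  fixed set of this form serves as the prediction for all of them. Against the set that spares
  \<open>j\<close>, a deterministic traveller pays at least its time of arrival at \<open>j\<close>. Until then its run does
  not depend on \<open>j\<close>, so the arrival times for different \<open>j\<close> are distinct odd numbers. They sum
  to at least \<open>(k + 1)\<^sup>2\<close>, and averaging over \<open>j\<close> (Yao's principle) gives \<open>k + 1\<close>.\<close>

section \<open>The family of hard instances\<close>

definition leaves :: "nat \<Rightarrow> nat set" where
  "leaves k = {2..k + 2}"

text \<open>The source is \<open>0\<close> and the destination is \<open>1\<close>; the graph is
  complete bipartite between these two and the leaves.\<close>

definition theta_edges :: "nat \<Rightarrow> nat set set" where
  "theta_edges k = (\<lambda>i. {0, i}) ` leaves k \<union> (\<lambda>i. {1, i}) ` leaves k"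

text \<open>Every blocked edge ends at the destination, so before arrival its state can be learnt
  only at its leaf.\<close>

definition all_but :: "nat \<Rightarrow> nat \<Rightarrow> nat set set" where
  "all_but k j = (\<lambda>i. {1, i}) ` (leaves k - {j})"

text \<open>Leaf \<open>2\<close> is an arbitrary choice for the prediction, which has to be the
  same for all \<open>j\<close>. Only moves from or to the source cost anything.\<close>

definition theta_input :: "nat \<Rightarrow> ctp_input" where
  "theta_input k = \<lparr>verts = {..k + 2}, edges = theta_edges k, source = 0, dest = 1,
     cost = (\<lambda>e. if 0 \<in> e then 1 else 0), predicted = all_but k 2\<rparr>"

lemma theta_input_simps [simp]:
  "verts (theta_input k) = {..k + 2}" "edges (theta_input k) = theta_edges k"
  "source (theta_input k) = 0" "dest (theta_input k) = 1"
  "cost (theta_input k) = (\<lambda>e. if 0 \<in> e then 1 else 0)"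
  "predicted (theta_input k) = all_but k 2"
  by (simp_all add: theta_input_def)

lemma finite_leaves [simp]: "finite (leaves k)"
  and card_leaves [simp]: "card (leaves k) = k + 1"
  and zero_notin_leaves [simp]: "0 \<notin> leaves k"
  and one_notin_leaves [simp]: "Suc 0 \<notin> leaves k"
  and two_in_leaves [simp]: "2 \<in> leaves k"
  by (simp_all add: leaves_def)

lemma theta_edge_iff:
  "{u, v} \<in> theta_edges k \<longleftrightarrow> u \<in> {0, 1} \<and> v \<in> leaves k \<or> v \<in> {0, 1} \<and> u \<in> leaves k"
  unfolding theta_edges_def Un_iff image_iff Bex_def doubleton_eq_iff insert_iff empty_iff by metis

lemma all_but_iff:
  "{u, v} \<in> all_but k j \<longleftrightarrow> u = 1 \<and> v \<in> leaves k - {j} \<or> v = 1 \<and> u \<in> leaves k - {j}"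
  unfolding all_but_def image_iff Bex_def doubleton_eq_iff by metis

lemma open_edge_iff:
  assumes "j \<in> leaves k"
  shows "{u, v} \<in> theta_edges k - all_but k j \<longleftrightarrow>
    u = 0 \<and> v \<in> leaves k \<or> v = 0 \<and> u \<in> leaves k \<or> u = 1 \<and> v = j \<or> v = 1 \<and> u = j"
proof -
  have "x \<noteq> 0" "x \<noteq> 1" if "x \<in> leaves k" for x
    using that by (auto simp: leaves_def)
  note leaf = this[of u] this[of v] this[OF assms]
  consider "u = 0" | "u = 1" | "u \<noteq> 0" "u \<noteq> 1" by blast
  then show ?thesis
  proof cases
    case 1
    then show ?thesis
      using leaf unfolding Diff_iff theta_edge_iff all_but_iff by simp
  next
    case 2
    then show ?thesis
      using leaf assms unfolding Diff_iff theta_edge_iff all_but_iff by auto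
  next
    case 3
    then show ?thesis
      using leaf assms unfolding Diff_iff theta_edge_iff all_but_iff by auto
  qed
qed

lemma card_all_but:
  assumes "j \<in> leaves k"
  shows "card (all_but k j) = k"
proof -
  have "inj_on (\<lambda>i. {1, i}) (leaves k - {j})"
    by (auto simp: inj_on_def doubleton_eq_iff)
  then show ?thesis
    using assms by (simp add: all_but_def card_image)
qed

text \<open>The two blocked sets differ at most in \<open>{1, i}\<close> and \<open>{1, j}\<close>,
  whose endpoints are all excluded.\<close>

lemma observe_all_but:
  assumes "u \<noteq> 1" "u \<noteq> i" "u \<noteq> j"
  shows "observe (all_but k i) u = observe (all_but k j) u"
proof -
  have "e \<in> all_but k l" if "u \<in> e" "e \<in> all_but k l'" "u \<noteq> l" for e l l'
  proof -
    obtain x where "e = {1, x}" "x \<in> leaves k"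
      using \<open>e \<in> all_but k l'\<close> unfolding all_but_def by blast
    then show ?thesis
      using that assms(1) by (auto simp: all_but_iff)
  qed
  then show ?thesis
    using assms(2,3) unfolding observe_def by blast
qed

section \<open>Paths in the graph and validity of the instances\<close>

lemma walk_edges_simps [simp]:
  "walk_edges [] = []" "walk_edges [u] = []"
  "walk_edges (u # v # p) = {u, v} # walk_edges (v # p)"
  by (simp_all add: walk_edges_def)

lemma walk_cost_simps [simp]:
  "walk_cost w [] = 0" "walk_cost w [u] = 0"
  "walk_cost w (u # v # p) = w {u, v} + walk_cost w (v # p)"
  by (simp_all add: walk_cost_def)

text \<open>A path alternates between \<open>{0, 1}\<close> and the leaves. It cannot return to
  \<open>0\<close>, so its third vertex is \<open>1\<close>, and distinctness leaves no room for a
  tail.\<close>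

lemma theta_path_cases:
  assumes "is_path (theta_edges k) 0 1 p"
  obtains i where "i \<in> leaves k" "p = [0, i, 1]"
proof -
  obtain q where q: "p = 0 # q" "q \<noteq> []"
    using assms by (cases p; cases "tl p") (auto simp: is_path_def)
  then obtain i r where r: "p = 0 # i # r"
    by (cases q) auto
  then have i: "i \<in> leaves k"
    using assms by (auto simp: is_path_def theta_edge_iff)
  have "r \<noteq> []"
    using assms r i by (auto simp: is_path_def)
  then obtain z r' where r': "p = 0 # i # z # r'"
    using r by (cases r) auto
  then have "{i, z} \<in> theta_edges k" "z \<noteq> 0"
    using assms by (auto simp: is_path_def)
  then have z: "z = 1"
    using i by (auto simp: theta_edge_iff)
  then have "r' \<noteq> [] \<Longrightarrow> last r' = 1" "1 \<notin> set r'"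
    using assms r' by (auto simp: is_path_def)
  then have "r' = []"
    by (metis last_in_set)
  then show thesis
    using that i r' z by simp
qed

text \<open>Only leaf \<open>j\<close> has an open last edge. The minimum in \<open>opt_cost\<close>
  thus ranges over a single path.\<close>

lemma theta_open_path_iff:
  assumes j: "j \<in> leaves k"
  shows "is_path (theta_edges k - all_but k j) 0 1 p \<longleftrightarrow> p = [0, j, 1]"
proof
  assume p: "is_path (theta_edges k - all_but k j) 0 1 p"
  then have "is_path (theta_edges k) 0 1 p"
    by (auto simp: is_path_def)
  then obtain i where i: "i \<in> leaves k" "p = [0, i, 1]"
    by (rule theta_path_cases)
  then have "{i, 1} \<in> theta_edges k - all_but k j"
    using p by (simp add: is_path_def)
  then show "p = [0, j, 1]"
    using i unfolding open_edge_iff[OF j] by auto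
next
  have "{0, j} \<in> theta_edges k - all_but k j" "{j, 1} \<in> theta_edges k - all_but k j"
    unfolding open_edge_iff[OF j] using j by auto
  moreover have "j \<noteq> 0" "j \<noteq> 1"
    using j by (auto simp: leaves_def)
  moreover assume "p = [0, j, 1]"
  ultimately show "is_path (theta_edges k - all_but k j) 0 1 p"
    by (simp add: is_path_def)
qed

lemma theta_connected: "connected_graph {..k + 2} (theta_edges k)"
proof -
  have edge: "{u, v} \<in> theta_edges k" "{v, u} \<in> theta_edges k"
    if "u \<in> {0, 1}" "v \<in> leaves k" for u v
    using that by (simp_all add: theta_edge_iff)
  have "\<exists>p. is_path (theta_edges k) u v p" if uv: "u \<le> k + 2" "v \<le> k + 2" for u v
  proof -
    have leaf: "x \<in> {0, 1} \<or> x \<in> leaves k" if "x \<le> k + 2" for x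
      using that by (auto simp: leaves_def)
    consider "u = v" | "u \<in> {0, 1}" "v \<in> {0, 1}" "u \<noteq> v" | "u \<in> {0, 1}" "v \<in> leaves k"
      | "v \<in> {0, 1}" "u \<in> leaves k" | "u \<in> leaves k" "v \<in> leaves k" "u \<noteq> v"
      using leaf[OF uv(1)] leaf[OF uv(2)] by argo
    then show ?thesis
    proof cases
      case 1
      then have "is_path (theta_edges k) u v [u]"
        by (simp add: is_path_def)
      then show ?thesis ..
    next
      case 2
      then have "is_path (theta_edges k) u v [u, 2, v]"
        using edge[of u 2] edge[of v 2] by (auto simp: is_path_def)
      then show ?thesis ..
    next
      case 3
      then have "is_path (theta_edges k) u v [u, v]"
        using edge[of u v] by (auto simp: is_path_def)
      then show ?thesis ..
    next
      case 4
      then have "is_path (theta_edges k) u v [u, v]"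
        using edge[of v u] by (auto simp: is_path_def)
      then show ?thesis ..
    next
      case 5
      then have "u \<noteq> 0" "v \<noteq> 0"
        by (auto simp: leaves_def)
      then have "is_path (theta_edges k) u v [u, 0, v]"
        using edge[of 0 u] edge[of 0 v] 5 by (auto simp: is_path_def)
      then show ?thesis ..
    qed
  qed
  moreover have "simple_graph {..k + 2} (theta_edges k)"
  proof -
    have "\<exists>u\<in>{..k + 2}. \<exists>v\<in>{..k + 2}. u \<noteq> v \<and> e = {u, v}" if "e \<in> theta_edges k" for e
    proof -
      obtain a i where "e = {a, i}" "a \<in> {0, 1}" "i \<in> leaves k"
        using \<open>e \<in> theta_edges k\<close> unfolding theta_edges_def by blast
      then show ?thesis
        by (intro bexI[of _ a] bexI[of _ i]) (auto simp: leaves_def)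
    qed
    then show ?thesis
      by (simp add: simple_graph_def)
  qed
  ultimately show ?thesis
    by (auto simp: connected_graph_def)
qed

lemma theta_instance:
  assumes j: "j \<in> leaves k"
  shows "ctp_instance k (theta_input k) (all_but k j)"
proof -
  have "all_but k i \<subseteq> theta_edges k" for i
    by (auto simp: all_but_def theta_edges_def)
  moreover have "\<exists>p. is_path (theta_edges k - all_but k j) 0 1 p"
    using theta_open_path_iff[OF j] by blast
  ultimately show ?thesis
    using theta_connected card_all_but[OF j] card_all_but[OF two_in_leaves]
    by (simp add: ctp_instance_def)
qed

lemma theta_path_disjoint: "path_disjoint (theta_input k)"
  unfolding path_disjoint_def theta_input_simps
proof (intro allI impI)
  fix p q
  assume pq: "is_path (theta_edges k) 0 1 p" "is_path (theta_edges k) 0 1 q" "p \<noteq> q"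
  obtain i where "p = [0, i, 1]"
    using pq(1) by (rule theta_path_cases)
  moreover obtain i' where "q = [0, i', 1]"
    using pq(2) by (rule theta_path_cases)
  ultimately show "set p \<inter> set q \<subseteq> {0, 1}"
    using pq(3) by auto
qed

lemma theta_prediction_error: "prediction_error (theta_input k) (all_but k j) \<le> 2"
proof -
  have "all_but k i - all_but k j \<subseteq> {{1, j}}" for i j
    unfolding all_but_def by fast
  then have "(all_but k j - all_but k 2) \<union> (all_but k 2 - all_but k j) \<subseteq> {{1, 2}, {1, j}}"
    by blast
  then have "prediction_error (theta_input k) (all_but k j) \<le> card {{1, 2}, {1, j}}"
    unfolding prediction_error_def theta_input_simps by (intro card_mono) auto
  also have "\<dots> \<le> 2"
    by (simp add: card_insert_if)
  finally show ?thesis .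
qed

lemma theta_opt_cost:
  assumes j: "j \<in> leaves k"
  shows "opt_cost (theta_input k) (all_but k j) = 1"
proof -
  have "j \<noteq> 0"
    using j by (auto simp: leaves_def)
  then show ?thesis
    unfolding opt_cost_def theta_input_simps theta_open_path_iff[OF j] by simp
qed

section \<open>General facts about runs\<close>

definition visited :: "history \<Rightarrow> nat set" where
  "visited h = fst ` set h"

lemma visited_Cons [simp]: "visited (observe B v # h) = insert v (visited h)"
  by (simp add: visited_def observe_def)

lemma fst_observe [simp]: "fst (observe B v) = v"
  by (simp add: observe_def)

declare run.simps(2) [simp del]

lemma run_nonempty [simp]: "run S I B n \<noteq> []"
  by (induction n) (auto simp: run.simps(2) Let_def)

lemma hd_in_visited: "fst (hd (run S I B n)) \<in> visited (run S I B n)"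
  by (simp add: visited_def)

text \<open>Stands in for \<open>run.simps(2)\<close> in inductions, without its \<open>let\<close>
  and \<open>if\<close>.\<close>

lemma run_Suc_cases:
  obtains (stay) "run S I B (Suc n) = run S I B n"
  | (move) u v where "u = fst (hd (run S I B n))" "v = S I (run S I B n)" "u \<noteq> dest I"
      "{u, v} \<in> edges I - B" "run S I B (Suc n) = observe B v # run S I B n"
proof -
  let ?h = "run S I B n"
  have "run S I B (Suc n) = ?h \<or> fst (hd ?h) \<noteq> dest I \<and> {fst (hd ?h), S I ?h} \<in> edges I - B \<and>
      run S I B (Suc n) = observe B (S I ?h) # ?h"
    by (simp add: run.simps(2) Let_def)
  then show thesis
    using stay move by blast
qed

lemma visited_run_mono:
  assumes "n \<le> m"
  shows "visited (run S I B n) \<subseteq> visited (run S I B m)"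
  using assms
proof (rule lift_Suc_mono_le[rotated])
  fix n
  show "visited (run S I B n) \<subseteq> visited (run S I B (Suc n))"
    by (cases S I B n rule: run_Suc_cases) auto
qed

lemma length_run_mono:
  assumes "n \<le> m"
  shows "length (run S I B n) \<le> length (run S I B m)"
  using assms
proof (rule lift_Suc_mono_le[rotated])
  fix n
  show "length (run S I B n) \<le> length (run S I B (Suc n))"
    by (cases S I B n rule: run_Suc_cases) auto
qed

lemma walk_cost_observe:
  assumes "h \<noteq> []"
  shows "walk_cost w (map fst (observe B v # h)) = w {v, fst (hd h)} + walk_cost w (map fst h)"
  using assms by (cases h) (auto simp: observe_def)

lemma walk_cost_run_mono:
  assumes "\<And>e. 0 \<le> w e" "n \<le> m"
  shows "walk_cost w (map fst (run S I B n)) \<le> walk_cost w (map fst (run S I B m))"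
  using assms(2)
proof (rule lift_Suc_mono_le[rotated])
  fix n
  show "walk_cost w (map fst (run S I B n)) \<le> walk_cost w (map fst (run S I B (Suc n)))"
  proof (cases S I B n rule: run_Suc_cases)
    case stay
    then show ?thesis by simp
  next
    case (move u v)
    then show ?thesis
      using walk_cost_observe[of "run S I B n" w B v] assms(1)[of "{v, u}"] by simp
  qed
qed

section \<open>Runs up to the entry of the open leaf\<close>

text \<open>The destination can be reached only from \<open>j\<close>, so until \<open>j\<close> is
  visited every move joins \<open>0\<close> and a leaf. The history starts with length 1 at the
  source and has one entry more than there were moves.\<close>

lemma run_before_visit:
  assumes j: "j \<in> leaves k"
    and "j \<notin> visited (run S (theta_input k) (all_but k j) n)"
  defines "h \<equiv> run S (theta_input k) (all_but k j) n"
  shows "1 \<notin> visited h" and "fst (hd h) = 0 \<longleftrightarrow> odd (length h)"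
    and "walk_cost (cost (theta_input k)) (map fst h) = real (length h) - 1"
proof -
  let ?w = "cost (theta_input k)"
  have "1 \<notin> visited h \<and> (fst (hd h) = 0 \<longleftrightarrow> odd (length h)) \<and>
      walk_cost ?w (map fst h) = real (length h) - 1"
    using assms(2) unfolding h_def
  proof (induction n)
    case 0
    show ?case by (simp add: observe_def visited_def)
  next
    case (Suc n)
    define g where "g = run S (theta_input k) (all_but k j) n"
    have "j \<notin> visited g"
      using Suc.prems visited_run_mono[OF le_SucI[OF order_refl]] unfolding g_def by blast
    then have IH: "1 \<notin> visited g" "fst (hd g) = 0 \<longleftrightarrow> odd (length g)"
        "walk_cost ?w (map fst g) = real (length g) - 1"
      using Suc.IH unfolding g_def by blast+
    show ?case
    proof (cases S "theta_input k" "all_but k j" n rule: run_Suc_cases)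
      case stay
      then show ?thesis
        using IH unfolding g_def by simp
    next
      case (move u v)
      have u: "u \<noteq> 1" "u \<noteq> j"
        using move(1) hd_in_visited IH(1) \<open>j \<notin> visited g\<close> unfolding g_def by metis+
      have "{u, v} \<in> theta_edges k - all_but k j"
        using move(4) by simp
      then have uv: "u = 0 \<and> v \<in> leaves k \<or> v = 0 \<and> u \<in> leaves k"
        unfolding open_edge_iff[OF j] using u by blast
      have eq: "run S (theta_input k) (all_but k j) (Suc n) = observe (all_but k j) v # g"
        using move(5) by (simp only: g_def)
      have g: "g \<noteq> []" "fst (hd g) = u"
        using move(1) by (simp_all add: g_def)
      \<comment> \<open>Exactly one end of the move is \<open>0\<close>, which gives both the unit
        cost and the change of parity.\<close>
      have "0 \<in> {v, u}" "v \<noteq> 1" "v = 0 \<longleftrightarrow> u \<noteq> 0"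
        using uv by (auto simp: leaves_def)
      then show ?thesis
        unfolding eq walk_cost_observe[OF g(1)] using IH g(2)
        by auto
    qed
  qed
  then show "1 \<notin> visited h" and "fst (hd h) = 0 \<longleftrightarrow> odd (length h)"
    and "walk_cost (cost (theta_input k)) (map fst h) = real (length h) - 1"
    by blast+
qed

text \<open>The state just before the first visit to \<open>j\<close>. Being at \<open>0\<close>
  makes the proposed move legal, as no edge at the source is blocked. The index \<open>n\<close>
  counts steps of \<open>run\<close>, including those in which the traveller stays.\<close>

definition enters :: "strategy \<Rightarrow> nat \<Rightarrow> nat \<Rightarrow> nat \<Rightarrow> bool" where
  "enters S k j n \<longleftrightarrow>
     (let h = run S (theta_input k) (all_but k j) n
      in j \<notin> visited h \<and> fst (hd h) = 0 \<and> S (theta_input k) h = j)"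

text \<open>The destination can be reached only through \<open>j\<close>; consider the step before
  the first visit to \<open>j\<close>.\<close>

lemma enters_before_dest:
  assumes j: "j \<in> leaves k" and "at_dest S (theta_input k) (all_but k j) N"
  obtains n where "n < N" "enters S k j n"
proof -
  let ?run = "run S (theta_input k) (all_but k j)"
  define m where "m = (LEAST m. j \<in> visited (?run m))"
  have dest: "fst (hd (?run N)) = 1"
    using assms(2) by (simp add: at_dest_def)
  have N: "j \<in> visited (?run N)"
    using run_before_visit(1)[OF j] hd_in_visited dest by metis
  have m: "j \<in> visited (?run m)" "m \<le> N"
    unfolding m_def using N by (auto intro: LeastI Least_le)
  have "m \<noteq> 0"
  proof
    assume "m = 0"
    then show False
      using m(1) j by (auto simp: visited_def observe_def leaves_def)
  qed
  then obtain n where n: "m = Suc n"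
    using not0_implies_Suc by blast
  have new: "j \<notin> visited (?run n)"
    using not_less_Least[of n "\<lambda>m. j \<in> visited (?run m)"] n unfolding m_def by auto
  have "enters S k j n"
  proof (cases S "theta_input k" "all_but k j" n rule: run_Suc_cases)
    case stay
    then show ?thesis
      using m(1) n new by simp
  next
    case (move u v)
    then have "v = j"
      using m(1) n new by simp
    moreover have "u \<noteq> 1"
      using move(3) by simp
    moreover have "{u, v} \<in> theta_edges k - all_but k j"
      using move(4) by simp
    \<comment> \<open>The open neighbours of \<open>j\<close> are \<open>0\<close> and
      \<open>1\<close>, and a trip that is at \<open>1\<close> has ended.\<close>
    ultimately have "u = 0"
      using j unfolding open_edge_iff[OF j] by (auto simp: leaves_def)
    then show ?thesis
      using move new \<open>v = j\<close> by (simp add: enters_def Let_def)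
  qed
  moreover have "n < N"
    using m(2) n by simp
  ultimately show thesis
    using that by blast
qed

text \<open>The history just before \<open>j\<close> is entered also lists the source, so its length counts the
  entering move too. The value is junk if \<open>j\<close> is never entered.\<close>

definition entry_time :: "strategy \<Rightarrow> nat \<Rightarrow> nat \<Rightarrow> nat" where
  "entry_time S k j = length (run S (theta_input k) (all_but k j) (SOME n. enters S k j n))"

text \<open>Edges at the source are never blocked, so a move from there to any leaf succeeds. This
  serves both for \<open>i = j\<close> and for a leaf \<open>i\<close> other than
  \<open>j\<close>.\<close>

lemma run_enters:
  assumes j: "j \<in> leaves k" and i: "i \<in> leaves k"
    and h: "run S (theta_input k) (all_but k j) n = h" "fst (hd h) = 0" "S (theta_input k) h = i"
  shows "run S (theta_input k) (all_but k j) (Suc n) = observe (all_but k j) i # h"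
proof -
  have "{0, i} \<in> theta_edges k - all_but k j"
    unfolding open_edge_iff[OF j] using i by blast
  then show ?thesis
    using h by (simp add: run.simps(2) Let_def)
qed

section \<open>Indistinguishability of the instances and distinct entry times\<close>

text \<open>As long as neither run has met its own open leaf, both give the traveller the same
  observations, so a deterministic strategy makes the same moves.\<close>

lemma runs_agree:
  assumes i: "i \<in> leaves k" and j: "j \<in> leaves k"
    and "i \<notin> visited (run S (theta_input k) (all_but k i) n)"
    and "j \<notin> visited (run S (theta_input k) (all_but k j) n)"
  shows "run S (theta_input k) (all_but k i) n = run S (theta_input k) (all_but k j) n"
  using assms(3,4)
proof (induction n)
  case 0
  have "i \<noteq> 0" "j \<noteq> 0"
    using i j by (auto simp: leaves_def)
  then show ?case
    using observe_all_but[of 0 i j k] by simp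
next
  case (Suc n)
  let ?I = "theta_input k"
  define h where "h = run S ?I (all_but k i) n"
  have fresh: "i \<notin> visited h" "j \<notin> visited (run S ?I (all_but k j) n)"
    using Suc.prems visited_run_mono[OF le_SucI[OF order_refl]] unfolding h_def by blast+
  have eq: "run S ?I (all_but k j) n = h"
    using Suc.IH fresh by (simp add: h_def)
  define u where "u = fst (hd h)"
  define v where "v = S ?I h"
  have "u \<in> visited h"
    unfolding u_def h_def by (rule hd_in_visited)
  moreover have "1 \<notin> visited h"
    using run_before_visit(1)[OF i] fresh(1) unfolding h_def by blast
  ultimately have u: "u \<noteq> 1" "u \<noteq> i" "u \<noteq> j"
    using fresh eq by auto
  \<comment> \<open>From such a \<open>u\<close>, both blocked sets allow the same moves.\<close>
  have open_iff: "{u, v} \<in> theta_edges k - all_but k l \<longleftrightarrow>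
      u = 0 \<and> v \<in> leaves k \<or> v = 0 \<and> u \<in> leaves k" if "l \<in> {i, j}" for l
    using that u i j open_edge_iff[of l k u v] by blast
  have step: "run S ?I (all_but k l) (Suc n) =
      (if {u, v} \<in> theta_edges k - all_but k l then observe (all_but k l) v # h else h)"
    if "l \<in> {i, j}" for l
    using that eq u(1) by (auto simp: run.simps(2) Let_def h_def u_def v_def)
  show ?case
  proof (cases "u = 0 \<and> v \<in> leaves k \<or> v = 0 \<and> u \<in> leaves k")
    case True
    then have runs: "run S ?I (all_but k l) (Suc n) = observe (all_but k l) v # h"
      if "l \<in> {i, j}" for l
      using that step open_iff by auto
    \<comment> \<open>The runs are assumed to avoid their open leaves up to step
      \<open>Suc n\<close>, so the observation at \<open>v\<close> agrees as well.\<close>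
    have "v \<noteq> i" "v \<noteq> j" "v \<noteq> 1"
      using Suc.prems runs[of i] runs[of j] True by (auto simp: leaves_def)
    then show ?thesis
      using runs[of i] runs[of j] observe_all_but[of v i j k] by simp
  next
    case False
    then show ?thesis
      using step[of i] step[of j] open_iff[of i] open_iff[of j] by auto
  qed
qed

text \<open>Up to step \<open>n\<close> the histories coincide, so with \<open>j\<close> open the
  traveller also moves to \<open>i\<close> next. That move is in its history before it enters
  \<open>j\<close>.\<close>

lemma length_at_entry_less:
  assumes i: "i \<in> leaves k" and j: "j \<in> leaves k" and "i \<noteq> j"
    and ei: "enters S k i n" and ej: "enters S k j m" and "n \<le> m"
  shows "length (run S (theta_input k) (all_but k i) n)
    < length (run S (theta_input k) (all_but k j) m)"
proof -
  let ?I = "theta_input k"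
  let ?h = "run S ?I (all_but k i) n"
  have "j \<notin> visited (run S ?I (all_but k j) n)"
    using ej visited_run_mono[OF \<open>n \<le> m\<close>] unfolding enters_def Let_def by blast
  then have eq: "run S ?I (all_but k j) n = ?h"
    using runs_agree[OF i j, symmetric] ei by (simp add: enters_def Let_def)
  \<comment> \<open>On the common history the strategy proposes only one vertex, so \<open>i\<close>
    and \<open>j\<close> cannot be entered at the same step.\<close>
  have "n \<noteq> m"
    using ei ej eq \<open>i \<noteq> j\<close> by (auto simp: enters_def Let_def)
  then have "Suc n \<le> m"
    using \<open>n \<le> m\<close> by simp
  have "run S ?I (all_but k j) (Suc n) = observe (all_but k j) i # ?h"
    using run_enters[OF j i eq] ei by (simp add: enters_def Let_def)
  then show ?thesis
    using length_run_mono[OF \<open>Suc n \<le> m\<close>, of S ?I "all_but k j"] by simp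
qed

text \<open>Any two entering steps are comparable, so \<open>length_at_entry_less\<close> separates
  the two leaves in one order or the other.\<close>

lemma entry_time_inj:
  assumes "\<And>j. j \<in> leaves k \<Longrightarrow> \<exists>n. enters S k j n"
  shows "inj_on (entry_time S k) (leaves k)"
proof (rule inj_onI, rule ccontr)
  fix i j
  assume ij: "i \<in> leaves k" "j \<in> leaves k" "entry_time S k i = entry_time S k j" "i \<noteq> j"
  have "enters S k i (SOME n. enters S k i n)" "enters S k j (SOME n. enters S k j n)"
    using assms ij by (auto intro: someI_ex)
  then show False
    using length_at_entry_less[of i k j S] length_at_entry_less[of j k i S] ij
    unfolding entry_time_def by (metis less_irrefl nat_le_linear)
qed

lemma odd_entry_time:
  assumes "j \<in> leaves k" "\<exists>n. enters S k j n"
  shows "odd (entry_time S k j)"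
  using someI_ex[OF assms(2)] run_before_visit(2)[OF assms(1)]
  unfolding entry_time_def enters_def Let_def by blast

text \<open>A visited leaf stays visited. This identifies the choice in \<open>entry_time\<close>
  with any entering step at hand.\<close>

lemma enters_unique:
  assumes j: "j \<in> leaves k" and "enters S k j n" "enters S k j m"
  shows "n = m"
proof -
  have "\<not> n' < m'" if "enters S k j n'" "enters S k j m'" for n' m'
  proof
    assume "n' < m'"
    then have "visited (run S (theta_input k) (all_but k j) (Suc n'))
        \<subseteq> visited (run S (theta_input k) (all_but k j) m')"
      by (intro visited_run_mono) simp
    moreover have "run S (theta_input k) (all_but k j) (Suc n')
        = observe (all_but k j) j # run S (theta_input k) (all_but k j) n'"
      using run_enters[OF j j refl] that(1) by (simp add: enters_def Let_def)
    ultimately show False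
      using that(2) by (simp add: enters_def Let_def)
  qed
  then show ?thesis
    using assms by (meson linorder_neqE_nat)
qed

text \<open>A finite cost means arrival, hence an earlier entry of \<open>j\<close>; later moves
  cannot lower the cost.\<close>

lemma entry_time_le_alg_cost:
  assumes j: "j \<in> leaves k" and fin: "alg_cost S (theta_input k) (all_but k j) \<noteq> \<infinity>"
  shows "\<exists>n. enters S k j n"
    and "ennreal (real (entry_time S k j)) \<le> alg_cost S (theta_input k) (all_but k j)"
proof -
  let ?I = "theta_input k"
  let ?run = "run S ?I (all_but k j)"
  define N where "N = (LEAST n. at_dest S ?I (all_but k j) n)"
  have ex: "\<exists>n. at_dest S ?I (all_but k j) n"
    using fin by (auto simp: alg_cost_def split: if_splits)
  then have "at_dest S ?I (all_but k j) N"
    unfolding N_def by (rule LeastI_ex)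
  then obtain n where n: "n < N" "enters S k j n"
    by (rule enters_before_dest[OF j])
  then show ex_n: "\<exists>n. enters S k j n" by blast
  have h: "j \<notin> visited (?run n)" "fst (hd (?run n)) = 0" "S ?I (?run n) = j"
    using n(2) by (simp_all add: enters_def Let_def)
  have "(SOME n. enters S k j n) = n"
    using enters_unique[OF j] n(2) by (metis someI_ex)
  then have "real (entry_time S k j) = real (length (?run n))"
    by (simp add: entry_time_def)
  \<comment> \<open>The move to \<open>j\<close> costs 1 and makes up for the 1 subtracted in
    \<open>run_before_visit\<close>.\<close>
  also have "\<dots> = walk_cost (cost ?I) (map fst (?run (Suc n)))"
    unfolding run_enters[OF j j refl h(2,3)] walk_cost_observe[OF run_nonempty]
      run_before_visit(3)[OF j h(1)] h(2) by simp
  also have "\<dots> \<le> walk_cost (cost ?I) (map fst (?run N))"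
    using n(1) by (intro walk_cost_run_mono) auto
  finally show "ennreal (real (entry_time S k j)) \<le> alg_cost S ?I (all_but k j)"
    using ex by (simp add: alg_cost_def N_def ennreal_leI)
qed

section \<open>The lower bound for deterministic strategies\<close>

text \<open>Remove the maximum \<open>b\<close>: there are \<open>b div 2\<close> odd numbers below
  it, so \<open>b\<close> is at least \<open>2 * card X + 1\<close>, the gap between consecutive
  squares.\<close>

lemma sum_odd_ge_card_squared:
  fixes X :: "nat set"
  assumes "finite X" "\<forall>x\<in>X. odd x"
  shows "(card X)\<^sup>2 \<le> \<Sum>X"
  using assms
proof (induction X rule: finite_linorder_max_induct)
  case empty
  show ?case by simp
next
  case (insert b X)
  have "x \<in> (\<lambda>i. 2 * i + 1) ` {..<b div 2}" if "x \<in> X" for x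
  proof -
    have "odd x" "x < b" "odd b"
      using insert that by auto
    then obtain a c where "x = 2 * a + 1" "b = 2 * c + 1"
      by (meson oddE)
    then show ?thesis
      using \<open>x < b\<close> by auto
  qed
  then have "card X \<le> card ((\<lambda>i. 2 * i + 1) ` {..<b div 2})"
    by (intro card_mono) auto
  also have "\<dots> \<le> b div 2"
    using card_image_le[of "{..<b div 2}"] by simp
  finally have "2 * card X + 1 \<le> b"
    using insert.prems by (auto elim!: oddE)
  moreover have "b \<notin> X"
    using insert by auto
  moreover have "(card X)\<^sup>2 \<le> \<Sum>X"
    using insert by simp
  ultimately show ?case
    using insert.hyps(1) by (simp add: power2_eq_square algebra_simps)
qed

text \<open>A strategy that fails to arrive for some \<open>j\<close> makes the sum infinite.
  Otherwise the entry times are \<open>k + 1\<close> distinct odd numbers.\<close>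

lemma sum_alg_cost_ge:
  "ennreal ((real k + 1)\<^sup>2) \<le> (\<Sum>j\<in>leaves k. alg_cost S (theta_input k) (all_but k j))"
proof (cases "\<exists>j\<in>leaves k. alg_cost S (theta_input k) (all_but k j) = \<infinity>")
  case True
  then obtain j where "j \<in> leaves k" "alg_cost S (theta_input k) (all_but k j) = \<infinity>"
    by blast
  then have "ennreal ((real k + 1)\<^sup>2) \<le> alg_cost S (theta_input k) (all_but k j)"
    by simp
  also have "\<dots> \<le> (\<Sum>j\<in>leaves k. alg_cost S (theta_input k) (all_but k j))"
    using \<open>j \<in> leaves k\<close> by (intro member_le_sum) auto
  finally show ?thesis .
next
  case False
  then have ex: "\<exists>n. enters S k j n"
    and le: "ennreal (real (entry_time S k j)) \<le> alg_cost S (theta_input k) (all_but k j)"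
    if "j \<in> leaves k" for j
    using that entry_time_le_alg_cost by blast+
  let ?T = "entry_time S k ` leaves k"
  have inj: "inj_on (entry_time S k) (leaves k)"
    using ex by (rule entry_time_inj)
  have "(card ?T)\<^sup>2 \<le> \<Sum>?T"
    using odd_entry_time ex by (intro sum_odd_ge_card_squared) auto
  \<comment> \<open>Injectivity enters twice: for the cardinality of \<open>?T\<close> and for
    reindexing the sum.\<close>
  then have "(k + 1)\<^sup>2 \<le> (\<Sum>j\<in>leaves k. entry_time S k j)"
    using inj by (simp add: card_image sum.reindex)
  then have "real ((k + 1)\<^sup>2) \<le> real (\<Sum>j\<in>leaves k. entry_time S k j)"
    by (simp only: of_nat_le_iff)
  then have "ennreal ((real k + 1)\<^sup>2) \<le> ennreal (\<Sum>j\<in>leaves k. real (entry_time S k j))"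
    by (intro ennreal_leI) (simp add: add.commute)
  also have "\<dots> = (\<Sum>j\<in>leaves k. ennreal (real (entry_time S k j)))"
    by simp
  also have "\<dots> \<le> (\<Sum>j\<in>leaves k. alg_cost S (theta_input k) (all_but k j))"
    using le by (rule sum_mono)
  finally show ?thesis .
qed

section \<open>Measurability and averaging over the random choices\<close>

text \<open>The type of histories is uncountable; but for fixed \<open>B\<close>, only countably many histories
  occur, which makes composition with the random strategy measurable.\<close>

lemma measurable_run:
  assumes "randomized_algorithm M A"
  shows "(\<lambda>r. run (A r) I B n) \<in> measurable M (count_space (range (map (observe B))))"
proof (induction n)
  case 0
  have "run S I B 0 \<in> range (map (observe B))" for S
    by (rule range_eqI[of _ _ "[source I]"]) simp
  then show ?case by simp
next
  case (Suc n)
  have A: "(\<lambda>r. A r I h) \<in> measurable M (count_space UNIV)" for h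
    using assms by (simp add: randomized_algorithm_def)
  define next_history where "next_history h v =
      (if fst (hd h) \<noteq> dest I \<and> {fst (hd h), v} \<in> edges I - B then observe B v # h else h)" for h v
  have "(\<lambda>r. next_history h (A r I h)) \<in> measurable M (count_space (range (map (observe B))))"
    if h: "h \<in> range (map (observe B))" for h
  proof -
    obtain vs where "h = map (observe B) vs"
      using h by blast
    then have "next_history h v = map (observe B) (v # vs) \<or> next_history h v = map (observe B) vs"
      for v by (simp add: next_history_def)
    then have "next_history h v \<in> range (map (observe B))" for v
      by (metis rangeI)
    then have "next_history h \<in> measurable (count_space UNIV) (count_space (range (map (observe B))))"
      by simp
    from measurable_compose[OF A this] show ?thesis .
  qed
  \<comment> \<open>Vertex lists are countable, so the random history may now be substituted for the
    fixed \<open>h\<close>.\<close>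
  then have "(\<lambda>r. next_history (run (A r) I B n) (A r I (run (A r) I B n)))
      \<in> measurable M (count_space (range (map (observe B))))"
    using Suc.IH countable_image[OF countableI_type] by (rule measurable_compose_countable')
  then show ?case
    by (simp add: next_history_def run.simps(2) Let_def)
qed

text \<open>The cost is read off at a random step number, which takes countably many values, so the
  composition is measurable.\<close>

lemma measurable_alg_cost:
  assumes "randomized_algorithm M A"
  shows "(\<lambda>r. alg_cost (A r) I B) \<in> borel_measurable M"
proof -
  have f: "(\<lambda>r. f (run (A r) I B n)) \<in> measurable M N" if "range f \<subseteq> space N" for f n N
  proof -
    have "f \<in> measurable (count_space (range (map (observe B)))) N"
      using that by auto
    from measurable_compose[OF measurable_run[OF assms] this] show ?thesis .
  qed
  have dest [measurable]: "Measurable.pred M (\<lambda>r. at_dest (A r) I B n)" for n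
    unfolding at_dest_def by (rule f) simp
  have cost: "(\<lambda>r. ennreal (walk_cost (cost I) (map fst (run (A r) I B n)))) \<in> borel_measurable M"
    for n by (rule f) simp
  \<comment> \<open>For a traveller that never arrives this number is a default, discarded by the
    \<open>if\<close> in \<open>alg_cost\<close>.\<close>
  have "(\<lambda>r. LEAST n. at_dest (A r) I B n) \<in> measurable M (count_space UNIV)"
    by measurable
  with cost have [measurable]: "(\<lambda>r. ennreal (walk_cost (cost I)
      (map fst (run (A r) I B (LEAST n. at_dest (A r) I B n))))) \<in> borel_measurable M"
    by (rule measurable_compose_countable)
  show ?thesis
    unfolding alg_cost_def by measurable
qed

text \<open>The deterministic bound holds for each outcome \<open>r\<close>; integrate it against
  total mass 1.\<close>

lemma sum_expected_cost_ge:
  assumes "randomized_algorithm M A"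
  shows "ennreal ((real k + 1)\<^sup>2)
    \<le> (\<Sum>j\<in>leaves k. expected_cost M A (theta_input k) (all_but k j))"
proof -
  interpret prob_space M
    using assms by (simp add: randomized_algorithm_def)
  have "ennreal ((real k + 1)\<^sup>2) = (\<integral>\<^sup>+ r. ennreal ((real k + 1)\<^sup>2) \<partial>M)"
    by (simp add: emeasure_space_1)
  also have "\<dots> \<le> (\<integral>\<^sup>+ r. (\<Sum>j\<in>leaves k. alg_cost (A r) (theta_input k) (all_but k j)) \<partial>M)"
    by (intro nn_integral_mono sum_alg_cost_ge)
  also have "\<dots> = (\<Sum>j\<in>leaves k. expected_cost M A (theta_input k) (all_but k j))"
    unfolding expected_cost_def by (intro nn_integral_sum measurable_alg_cost assms)
  finally show ?thesis .
qed

theorem theorem13: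
  fixes k :: nat and c :: real and M :: "'r measure" and A :: "'r \<Rightarrow> strategy"
  assumes "k \<ge> 1"
    and "c < real k + 1"
    and "randomized_algorithm M A"
  shows "\<exists>I B. ctp_instance k I B \<and> prediction_error I B \<le> 2 \<and> path_disjoint I \<and>
           ereal (c * opt_cost I B) < enn2ereal (expected_cost M A I B)"
proof -
  let ?I = "theta_input k"
  let ?E = "\<lambda>j. expected_cost M A ?I (all_but k j)"
  \<comment> \<open>If all \<open>k + 1\<close> expected costs were at most \<open>c\<close>, their
    sum would be at most \<open>(k + 1) * c\<close>, below the bound just obtained.\<close>
  have "\<exists>j\<in>leaves k. ereal c < enn2ereal (?E j)"
  proof (rule ccontr)
    assume "\<not> ?thesis"
    then have le: "enn2ereal (?E j) \<le> ereal c" if "j \<in> leaves k" for j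
      using that by (auto simp: not_less)
    \<comment> \<open>Expected costs are nonnegative, hence so is \<open>c\<close>;
      \<open>ennreal\<close> would truncate a negative \<open>c\<close> to 0.\<close>
    have "0 \<le> ereal c"
      using le[OF two_in_leaves] order_trans[OF enn2ereal_nonneg] by blast
    then have c: "0 \<le> c" by simp
    have "?E j \<le> ennreal c" if "j \<in> leaves k" for j
      using le[OF that] c by (simp add: less_eq_ennreal.rep_eq)
    then have "(\<Sum>j\<in>leaves k. ?E j) \<le> (\<Sum>j\<in>leaves k. ennreal c)"
      by (rule sum_mono)
    also have "\<dots> = ennreal (\<Sum>j\<in>leaves k. c)"
      using c by (intro sum_ennreal) simp
    finally have "ennreal ((real k + 1)\<^sup>2) \<le> ennreal ((real k + 1) * c)"
      using sum_expected_cost_ge[OF assms(3), of k] by (simp add: add.commute)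
    then have "(real k + 1)\<^sup>2 \<le> (real k + 1) * c"
      using c by simp
    then show False
      using assms(2) by (simp add: power2_eq_square)
  qed
  then obtain j where j: "j \<in> leaves k" "ereal c < enn2ereal (?E j)" by blast
  then show ?thesis
    using theta_instance[OF j(1)] theta_prediction_error[of k j] theta_path_disjoint[of k]
      theta_opt_cost[OF j(1)] by (intro exI[of _ ?I] exI[of _ "all_but k j"]) simp
qed

end
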